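(* Let $G=(X,w,\mu)$ and $G'=(X',w',\mu')$ be two graphs, with normalizations $\hat G=(X,w,\deg)$ and $\hat G'=(X',w',\deg')$. Then $G$ and $G'$ are stochastically equivalent if and only if there exists a bijection $\phi:X\to X'$ such that $\hat G\hookrightarrow_\phi \hat G'$ and $\hat G'\hookrightarrow_{\phi^{-1}}\hat G$. In particular, given a graph $G=(X,w,\boldsymbol 1)$ with fractional graph $G^\alpha$ ($\alpha\in(0,1)$) and path graph $G_\alpha$ ($\alpha\in(0,+\infty)$): $G^\alpha$ is compatible with $G$ if and only if $\hat G\hookrightarrow_{\operatorname{id}}\hat G^\alpha$, and $G_\alpha$ is compatible with $G$ if and only if $\hat G\hookrightarrow_{\operatorname{id}}\hat G_\alpha$, where $\hat G^\alpha,\hat G_\alpha$ denote the normalizations of $G^\alpha, G_\alpha$ and $\operatorname{id}:X\to X$ is the identity map.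
   Context: **Graphs.** A graph is a triple $G=(X,w,\mu)$ where $X=\{x_i: i\in I\}$ is a finite node set with at least two nodes, $w:X\times X\to[0,\infty)$ is symmetric with $w(x,x)=0$ for all $x$, and $\mu:X\to(0,\infty)$. A pair $\{x,y\}$ is an edge (written $x\sim y$) iff $w(x,y)>0$. All graphs are assumed connected. The degree is $\deg(x)=\sum_{y\in X}w(x,y)$ (positive by connectedness). The measure $\mu$ is always either the counting measure $\boldsymbol 1\equiv 1$ or the degree measure $\deg$. The normalization of $G$ is $\hat G=(X,w,\deg)$. The transition probabilities of $G$ are $p_{i,j}=w(x_i,x_j)/\deg(x_i)$. The graph Laplacian of $G=(X,w,\mu)$ is $\Delta[u](x)=\frac1{\mu(x)}\sum_{y\in X}w(x,y)(u(x)-u(y))$ for $u:X\to\mathbb R$. **$\phi$-induced subgraph.** Let $G=(X,w,\mu)$, $G'=(X',w',\mu')$ be graphs and $\phi:X\to\phi(X)\subseteq X'$ a bijection onto its image satisfying (E1): for every edge $\{x,y\}$ of $G$, $\{\phi(x),\phi(y)\}$ is an edge of $G'$. The $\phi$-induced subgraph of $G'$ is $\phi(G)=(\phi(X),w_\phi,\mu_\phi)$, where $w_\phi(x',y')=w'(x',y')$ if $\{\phi^{-1}(x'),\phi^{-1}(y')\}$ is an edge of $G$ and $w_\phi(x',y')=0$ otherwise, and $\mu_\phi=\boldsymbol 1$ if $\mu'$ is the counting measure, while $\mu_\phi(x')=\deg_\phi(x'):=\sum_{y'\in\phi(X)}w_\phi(x',y')$ if $\mu'$ is the degree measure. **Embedding.**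 $G\hookrightarrow_\phi G'$ means: $\phi:X\to\phi(X)\subseteq X'$ is a bijection onto its image satisfying (E1), and for every $u:X\to\mathbb R$ and $x\in X$, $\Delta[u](x)=\Delta_{\phi(G)}[u\circ\phi^{-1}](\phi(x))$, where $\Delta$ is the graph Laplacian of $G$ and $\Delta_{\phi(G)}$ is the graph Laplacian of $\phi(G)$. **Stochastic equivalence.** $G$ and $G'$ are stochastically equivalent if there is a bijection $\psi:I\to I'$ of their index sets with $p_{i,j}=p'_{\psi(i),\psi(j)}$ for all $i,j\in I$. **Compatibility.** Let $G,G'$ be graphs with $X\subseteq X'$ such that every edge of $G$ is an edge of $G'$. $G'$ is compatible with $G$ if $G$ and $\operatorname{id}(G)$ (the $\phi$-induced subgraph of $G'$ for $\phi=\operatorname{id}$ the inclusion of $X$ in $X'$) are stochastically equivalent via the identity of the index set of $X$, i.e. have the same transition probabilities. **Fractional graph.** For $G=(X,w,\boldsymbol 1)$ with graph Laplacian $\Delta$ (a symmetric positive semidefinite matrix) and $\alpha\in(0,1)$, $\Delta^\alpha=U\Lambda^\alpha U^T$ where $\Delta=U\Lambda U^T$ is a spectral decomposition. $G^\alpha=(X,w^\alpha,\boldsymbol 1)$ is the complete graph with $w^\alpha(x_i,x_j)=-(\Delta^\alpha)_{i,j}$ for $i\ne j$ (these are positive), whose graph Laplacian is $\Delta^\alpha$. **Path graph.** Fix a distance function $d_w$ on $X$ (possibly depending on $w$) and a family $h_\alpha:\mathbb R_+\to(0,+\infty)$, $\alpha\in(0,+\infty)$. Let $\delta$ be the combinatorial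 distance of $G$ (least number of edges of a walk joining two nodes) and $\delta_\infty$ its maximum. Put $\kappa_{\alpha,n}(x,y)=h_\alpha(d_w(x,y))$ if $\delta(x,y)=n$ and $0$ otherwise. The path graph of $G=(X,w,\boldsymbol 1)$ is $G_\alpha=(X,w_\alpha,\boldsymbol 1)$ with $w_\alpha(x,y)=\sum_{n=1}^{\delta_\infty}\kappa_{\alpha,n}(x,y)$. *)

theory Defs
  imports "HOL-Analysis.Analysis"
begin

text \<open>
  The index set of a graph is the finite type \<open>'i\<close>, and the nodes are \<open>x\<^sub>i = node G i\<close>.
  Since the measure of a graph is always the counting or the degree measure, it is recorded
  by a tag. With the tag, the measure of an induced subgraph is determined also when the two
  measures of the ambient graph happen to agree (all degrees equal to \<open>1\<close>).
\<close>

datatype graph_measure = Counting | Degree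

record ('i, 'a) wgraph =
  node :: "'i \<Rightarrow> 'a"
  weight :: "'a \<Rightarrow> 'a \<Rightarrow> real"
  gmeas :: graph_measure

definition nodes :: "('i, 'a) wgraph \<Rightarrow> 'a set" where
  "nodes G = range (node G)"

definition edge :: "('i, 'a) wgraph \<Rightarrow> 'a \<Rightarrow> 'a \<Rightarrow> bool" where
  "edge G x y \<longleftrightarrow> x \<in> nodes G \<and> y \<in> nodes G \<and> weight G x y > 0"

definition is_graph :: "('i::finite, 'a) wgraph \<Rightarrow> bool" where
  "is_graph G \<longleftrightarrow>
     inj (node G) \<and> card (nodes G) \<ge> 2 \<and>
     (\<forall>x\<in>nodes G. \<forall>y\<in>nodes G. weight G x y \<ge> 0 \<and> weight G x y = weight G y x) \<and>
     (\<forall>x\<in>nodes G. weight G x x = 0) \<and>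
     (\<forall>x\<in>nodes G. \<forall>y\<in>nodes G. (edge G)\<^sup>*\<^sup>* x y)"

definition deg :: "('i, 'a) wgraph \<Rightarrow> 'a \<Rightarrow> real" where
  "deg G x = (\<Sum>y\<in>nodes G. weight G x y)"

definition mu :: "('i, 'a) wgraph \<Rightarrow> 'a \<Rightarrow> real" where
  "mu G x = (case gmeas G of Counting \<Rightarrow> 1 | Degree \<Rightarrow> deg G x)"

definition normalization :: "('i, 'a) wgraph \<Rightarrow> ('i, 'a) wgraph" where
  "normalization G = G\<lparr>gmeas := Degree\<rparr>"

definition trans_prob :: "('i, 'a) wgraph \<Rightarrow> 'i \<Rightarrow> 'i \<Rightarrow> real" where
  "trans_prob G i j = weight G (node G i) (node G j) / deg G (node G i)"

definition laplacian :: "('i, 'a) wgraph \<Rightarrow> ('a \<Rightarrow> real) \<Rightarrow> 'a \<Rightarrow> real" where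
  "laplacian G u x = 1 / mu G x * (\<Sum>y\<in>nodes G. weight G x y * (u x - u y))"

definition preserves_edges ::
  "('a \<Rightarrow> 'b) \<Rightarrow> ('i, 'a) wgraph \<Rightarrow> ('j, 'b) wgraph \<Rightarrow> bool" where
  "preserves_edges \<phi> G G' \<longleftrightarrow> (\<forall>x y. edge G x y \<longrightarrow> edge G' (\<phi> x) (\<phi> y))"

text \<open>The \<open>\<phi>\<close>-induced subgraph of \<open>G'\<close> carries the index set of \<open>G\<close>.\<close>

definition induced ::
  "('a \<Rightarrow> 'b) \<Rightarrow> ('i, 'a) wgraph \<Rightarrow> ('j, 'b) wgraph \<Rightarrow> ('i, 'b) wgraph" where
  "induced \<phi> G G' =
     \<lparr>node = \<phi> \<circ> node G,
      weight = (\<lambda>x' y'.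
        if x' \<in> \<phi> ` nodes G \<and> y' \<in> \<phi> ` nodes G \<and>
           edge G (inv_into (nodes G) \<phi> x') (inv_into (nodes G) \<phi> y')
        then weight G' x' y' else 0),
      gmeas = gmeas G'\<rparr>"

definition embeds ::
  "('a \<Rightarrow> 'b) \<Rightarrow> ('i, 'a) wgraph \<Rightarrow> ('j, 'b) wgraph \<Rightarrow> bool" where
  "embeds \<phi> G G' \<longleftrightarrow>
     inj_on \<phi> (nodes G) \<and> \<phi> ` nodes G \<subseteq> nodes G' \<and> preserves_edges \<phi> G G' \<and>
     (\<forall>u. \<forall>x\<in>nodes G.
        laplacian G u x = laplacian (induced \<phi> G G') (u \<circ> inv_into (nodes G) \<phi>) (\<phi> x))"

definition stoch_equiv_via ::
  "('i \<Rightarrow> 'j) \<Rightarrow> ('i, 'a) wgraph \<Rightarrow> ('j, 'b) wgraph \<Rightarrow> bool" where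
  "stoch_equiv_via \<psi> G G' \<longleftrightarrow>
     bij \<psi> \<and> (\<forall>i j. trans_prob G i j = trans_prob G' (\<psi> i) (\<psi> j))"

definition stoch_equiv :: "('i, 'a) wgraph \<Rightarrow> ('j, 'b) wgraph \<Rightarrow> bool" where
  "stoch_equiv G G' \<longleftrightarrow> (\<exists>\<psi>. stoch_equiv_via \<psi> G G')"

text \<open>\<open>compatible G' G\<close>: the graph \<open>G'\<close> is compatible with \<open>G\<close>.\<close>

definition compatible :: "('j, 'a) wgraph \<Rightarrow> ('i, 'a) wgraph \<Rightarrow> bool" where
  "compatible G' G \<longleftrightarrow>
     nodes G \<subseteq> nodes G' \<and> preserves_edges id G G' \<and> stoch_equiv_via id G (induced id G G')"

definition diag_mat :: "real^'n \<Rightarrow> real^'n^'n" where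
  "diag_mat v = (\<chi> i j. if i = j then v $ i else 0)"

definition spectral_decomposition :: "real^'n^'n \<Rightarrow> real^'n^'n \<Rightarrow> real^'n \<Rightarrow> bool" where
  "spectral_decomposition A U v \<longleftrightarrow>
     orthogonal_matrix U \<and> A = U ** diag_mat v ** transpose U"

text \<open>
  A spectral decomposition exists for every symmetric \<open>A\<close>; the power does not depend on which
  one is chosen (\<open>mat_powr_eq\<close> below). For a positive semidefinite \<open>A\<close> the entries of \<open>v\<close> are
  nonnegative, and \<open>0 powr \<alpha> = 0\<close>.
\<close>

definition mat_powr :: "real^'n^'n \<Rightarrow> real \<Rightarrow> real^'n^'n" where
  "mat_powr A \<alpha> =
     (SOME P. \<exists>U v. spectral_decomposition A U v \<and>
        P = U ** diag_mat (\<chi> i. v $ i powr \<alpha>) ** transpose U)"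

lemma diag_mat_mult_right: "(A ** diag_mat v) $ i $ j = A $ i $ j * v $ j"
  by (simp add: matrix_matrix_mult_def diag_mat_def if_distrib cong: if_cong)

lemma diag_mat_mult_left: "(diag_mat v ** A) $ i $ j = v $ i * A $ i $ j"
  by (simp add: matrix_matrix_mult_def diag_mat_def if_distrib if_distribR cong: if_cong)

lemma spectral_power_unique:
  fixes A U V :: "real^'n^'n"
  assumes "spectral_decomposition A U v" "spectral_decomposition A V u"
  shows "U ** diag_mat (\<chi> i. v $ i powr \<alpha>) ** transpose U =
         V ** diag_mat (\<chi> i. u $ i powr \<alpha>) ** transpose V"
proof -
  have U: "transpose U ** U = mat 1" "U ** transpose U = mat 1"
    and V: "transpose V ** V = mat 1" "V ** transpose V = mat 1"
    and eq: "U ** diag_mat v ** transpose U = V ** diag_mat u ** transpose V"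
    using assms by (auto simp: spectral_decomposition_def orthogonal_matrix_def)
  define W where "W = transpose V ** U"
  have "transpose V ** (U ** diag_mat v ** transpose U) ** U =
        transpose V ** (V ** diag_mat u ** transpose V) ** U"
    by (simp add: eq)
  then have "W ** diag_mat v ** (transpose U ** U) =
             (transpose V ** V) ** diag_mat u ** W"
    by (simp only: W_def matrix_mul_assoc)
  then have *: "W ** diag_mat v = diag_mat u ** W"
    by (simp add: U V)
  have "W $ i $ j * (v $ j powr \<alpha>) = (u $ i powr \<alpha>) * W $ i $ j" for i j
  proof -
    have "W $ i $ j * v $ j = u $ i * W $ i $ j"
      using arg_cong[OF *, of "\<lambda>M. M $ i $ j"]
      by (simp add: diag_mat_mult_right diag_mat_mult_left)
    then show ?thesis by (cases "W $ i $ j = 0") auto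
  qed
  then have W: "W ** diag_mat (\<chi> i. v $ i powr \<alpha>) = diag_mat (\<chi> i. u $ i powr \<alpha>) ** W"
    by (simp add: vec_eq_iff diag_mat_mult_right diag_mat_mult_left)
  have "(V ** transpose V) ** U ** diag_mat (\<chi> i. v $ i powr \<alpha>) ** transpose U =
        V ** (W ** diag_mat (\<chi> i. v $ i powr \<alpha>)) ** transpose U"
    by (simp only: W_def matrix_mul_assoc)
  also have "\<dots> = V ** diag_mat (\<chi> i. u $ i powr \<alpha>) ** transpose V ** (U ** transpose U)"
    by (simp only: W) (simp only: W_def matrix_mul_assoc)
  finally show ?thesis by (simp add: U V)
qed

lemma mat_powr_eq:
  assumes "spectral_decomposition A U v"
  shows "mat_powr A \<alpha> = U ** diag_mat (\<chi> i. v $ i powr \<alpha>) ** transpose U"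
  unfolding mat_powr_def
proof (rule some_equality)
  show "\<exists>U' v'. spectral_decomposition A U' v' \<and>
          U ** diag_mat (\<chi> i. v $ i powr \<alpha>) ** transpose U =
          U' ** diag_mat (\<chi> i. v' $ i powr \<alpha>) ** transpose U'"
    using assms by blast
qed (use assms spectral_power_unique in blast)

text \<open>Column \<open>j\<close> of the matrix of the graph Laplacian is the image of the indicator of \<open>x\<^sub>j\<close>.\<close>

definition laplacian_matrix :: "('i::finite, 'a) wgraph \<Rightarrow> real^'i^'i" where
  "laplacian_matrix G = (\<chi> i j. laplacian G (indicator {node G j}) (node G i))"

definition fractional_graph :: "real \<Rightarrow> ('i::finite, 'a) wgraph \<Rightarrow> ('i, 'a) wgraph" where
  "fractional_graph \<alpha> G =
     \<lparr>node = node G,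
      weight = (\<lambda>x y. if x = y then 0
        else - (mat_powr (laplacian_matrix G) \<alpha> $ inv (node G) x $ inv (node G) y)),
      gmeas = Counting\<rparr>"

definition comb_dist :: "('i, 'a) wgraph \<Rightarrow> 'a \<Rightarrow> 'a \<Rightarrow> nat" where
  "comb_dist G x y = (LEAST n. (edge G ^^ n) x y)"

definition comb_diameter :: "('i, 'a) wgraph \<Rightarrow> nat" where
  "comb_diameter G = Max {comb_dist G x y | x y. x \<in> nodes G \<and> y \<in> nodes G}"

text \<open>
  \<open>d w\<close> is the distance function on the nodes for the weight \<open>w\<close>, and \<open>h \<alpha>\<close> is the member of the
  family of profiles with parameter \<open>\<alpha>\<close>.
\<close>

definition path_kernel ::
  "(('a \<Rightarrow> 'a \<Rightarrow> real) \<Rightarrow> 'a \<Rightarrow> 'a \<Rightarrow> real) \<Rightarrow> (real \<Rightarrow> real \<Rightarrow> real) \<Rightarrow>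
   ('i, 'a) wgraph \<Rightarrow> real \<Rightarrow> nat \<Rightarrow> 'a \<Rightarrow> 'a \<Rightarrow> real" where
  "path_kernel d h G \<alpha> n x y =
     (if comb_dist G x y = n then h \<alpha> (d (weight G) x y) else 0)"

definition path_graph ::
  "(('a \<Rightarrow> 'a \<Rightarrow> real) \<Rightarrow> 'a \<Rightarrow> 'a \<Rightarrow> real) \<Rightarrow> (real \<Rightarrow> real \<Rightarrow> real) \<Rightarrow>
   real \<Rightarrow> ('i, 'a) wgraph \<Rightarrow> ('i, 'a) wgraph" where
  "path_graph d h \<alpha> G =
     \<lparr>node = node G,
      weight = (\<lambda>x y. \<Sum>n = 1..comb_diameter G. path_kernel d h G \<alpha> n x y),
      gmeas = Counting\<rparr>"

end

theory Submission
  imports Defs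
begin

text \<open>
  On a normalized graph the Laplacian is \<open>\<Sum>\<^sub>j p\<^sub>i\<^sub>j (u\<^sub>i - u\<^sub>j)\<close>, and testing it on indicator
  functions recovers the \<open>p\<^sub>i\<^sub>j\<close> with \<open>i \<noteq> j\<close>; there are no loops, so normalized embeddings are
  exactly the edge-preserving injections under which the induced subgraph has the same
  transition probabilities. This is compatibility when \<open>\<phi> = id\<close>, whatever the ambient graph; if
  edges are preserved in both directions, the induced subgraph is the whole ambient graph.
\<close>

lemma is_graphD:
  assumes "is_graph G"
  shows "inj (node G)"
    and "weight G (node G i) (node G i) = 0"
    and "weight G (node G i) (node G j) \<ge> 0"
  using assms by (auto simp: is_graph_def nodes_def)

lemma normalization_simps [simp]:
  "node (normalization G) = node G"
  "weight (normalization G) = weight G"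
  "nodes (normalization G) = nodes G"
  "edge (normalization G) = edge G"
  "deg (normalization G) = deg G"
  "mu (normalization G) = deg G"
  by (auto simp: normalization_def nodes_def edge_def deg_def mu_def fun_eq_iff)

lemma induced_normalization:
  "induced \<phi> (normalization G) (normalization G') = normalization (induced \<phi> G G')"
  unfolding induced_def normalization_simps by (simp add: normalization_def)

lemma node_induced [simp]: "node (induced \<phi> G G') i = \<phi> (node G i)"
  by (simp add: induced_def)

lemma nodes_induced [simp]: "nodes (induced \<phi> G G') = \<phi> ` nodes G"
  by (auto simp: induced_def nodes_def)

lemma weight_induced:
  assumes "inj_on \<phi> (nodes G)" "x \<in> nodes G" "y \<in> nodes G"
  shows "weight (induced \<phi> G G') (\<phi> x) (\<phi> y) =
    (if edge G x y then weight G' (\<phi> x) (\<phi> y) else 0)"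
  using assms by (simp add: induced_def)

lemma node_in_nodes [simp]: "node G i \<in> nodes G"
  by (simp add: nodes_def)

text \<open>Injectivity of \<open>node H\<close> turns the sum over nodes into a sum over indices.
  At a node of degree 0 both sides are 0, since division by 0 yields 0.\<close>

lemma laplacian_normalization:
  fixes H :: "('i::finite, 'a) wgraph"
  assumes "inj (node H)"
  shows "laplacian (normalization H) u (node H i) =
    (\<Sum>j\<in>UNIV. trans_prob H i j * (u (node H i) - u (node H j)))"
  using assms
  by (simp add: laplacian_def nodes_def sum.reindex trans_prob_def sum_divide_distrib o_def)

lemma embeds_normalization_iff:
  assumes G: "is_graph G"
  shows "embeds \<phi> (normalization G) (normalization G') \<longleftrightarrow>
    inj_on \<phi> (nodes G) \<and> \<phi> ` nodes G \<subseteq> nodes G' \<and> preserves_edges \<phi> G G' \<and>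
    (\<forall>i j. trans_prob G i j = trans_prob (induced \<phi> G G') i j)"
proof -
  let ?H = "induced \<phi> G G'"
  have "(\<forall>u. \<forall>x\<in>nodes G. laplacian (normalization G) u x =
      laplacian (normalization ?H) (u \<circ> inv_into (nodes G) \<phi>) (\<phi> x)) \<longleftrightarrow>
    (\<forall>i j. trans_prob G i j = trans_prob ?H i j)" (is "?L \<longleftrightarrow> ?R")
    if inj: "inj_on \<phi> (nodes G)"
  proof -
    have "inj (\<phi> \<circ> node G)"
      using is_graphD(1)[OF G] inj by (intro comp_inj_on) (auto simp: nodes_def)
    then have "inj (node ?H)"
      by (simp add: induced_def)
    \<comment> \<open>At image nodes \<open>inv_into\<close> cancels against \<open>\<phi>\<close>,
      so both Laplacians are tested on the same values of \<open>u\<close>.\<close>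
    then have H: "laplacian (normalization ?H) (u \<circ> inv_into (nodes G) \<phi>) (\<phi> (node G i)) =
        (\<Sum>j\<in>UNIV. trans_prob ?H i j * (u (node G i) - u (node G j)))" for u i
      using laplacian_normalization[of ?H "u \<circ> inv_into (nodes G) \<phi>" i] inj by simp
    have L: "?L \<longleftrightarrow> (\<forall>u i. (\<Sum>j\<in>UNIV. trans_prob G i j * (u (node G i) - u (node G j))) =
        (\<Sum>j\<in>UNIV. trans_prob ?H i j * (u (node G i) - u (node G j))))"
      by (simp add: nodes_def[of G] laplacian_normalization[OF is_graphD(1)[OF G]]
          H[unfolded nodes_def[of G]])
    show ?thesis
    proof
      assume ?R
      then show ?L unfolding L by simp
    next
      assume ?L
      show ?R
      proof (intro allI)
        fix i j
        show "trans_prob G i j = trans_prob ?H i j"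
        proof (cases "i = j")
          \<comment> \<open>The Laplacian cannot see diagonal entries; here both vanish, as
            \<open>G\<close> has no loops and the induced weight is 0 off the edges of
            \<open>G\<close>.\<close>
          case True
          then show ?thesis
            using is_graphD(2)[OF G, of j] weight_induced[OF inj, of "node G j" "node G j" G']
            by (simp add: trans_prob_def edge_def)
        next
          case False
          \<comment> \<open>At \<open>node G i\<close> with \<open>i \<noteq> j\<close>, the
            indicator of \<open>node G j\<close> leaves only the summand
            \<open>k = j\<close>.\<close>
          have "(\<Sum>k\<in>UNIV. p k * (indicator {node G j} (node G i) -
              indicator {node G j} (node G k))) = - p j" for p :: "'a \<Rightarrow> real"
            using False is_graphD(1)[OF G]
            by (simp add: indicator_def inj_eq sum_negf if_distrib[of "\<lambda>x. _ * x"]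
                cong: if_cong)
          then show ?thesis
            using \<open>?L\<close>[unfolded L, rule_format, of i "indicator {node G j}"] by simp
        qed
      qed
    qed
  qed
  then show ?thesis
    by (auto simp: embeds_def induced_normalization preserves_edges_def)
qed

text \<open>Serves the fractional and the path graph alike, each taken as \<open>G'\<close>.\<close>

lemma embeds_id_normalization_iff_compatible:
  assumes "is_graph G"
  shows "compatible G' G \<longleftrightarrow> embeds id (normalization G) (normalization G')"
  by (auto simp: embeds_normalization_iff[OF assms] compatible_def stoch_equiv_via_def)

text \<open>Since \<open>\<phi>\<close> is onto and reflects edges, passing to the induced subgraph
  loses neither nodes nor positive weights. The map \<open>\<psi>\<close> is \<open>\<phi>\<close>
  read on indices.\<close>

lemma trans_prob_induced_bij:
  fixes G :: "('i::finite, 'a) wgraph" and G' :: "('j::finite, 'b) wgraph"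
  assumes G': "is_graph G'"
    and \<phi>: "bij_betw \<phi> (nodes G) (nodes G')"
    and refl: "\<And>x y. x \<in> nodes G \<Longrightarrow> y \<in> nodes G \<Longrightarrow> edge G' (\<phi> x) (\<phi> y) \<Longrightarrow> edge G x y"
    and \<psi>: "\<And>i. node G' (\<psi> i) = \<phi> (node G i)"
  shows "trans_prob (induced \<phi> G G') i j = trans_prob G' (\<psi> i) (\<psi> j)"
proof -
  have inj: "inj_on \<phi> (nodes G)" and im: "\<phi> ` nodes G = nodes G'"
    using \<phi> by (auto simp: bij_betw_def)
  have w: "weight (induced \<phi> G G') (\<phi> x) (\<phi> y) = weight G' (\<phi> x) (\<phi> y)"
    if "x \<in> nodes G" "y \<in> nodes G" for x y
  proof -
    have "\<phi> x \<in> nodes G'" "\<phi> y \<in> nodes G'"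
      using that im by auto
    moreover from this have "weight G' (\<phi> x) (\<phi> y) \<ge> 0"
      using G' by (simp add: is_graph_def)
    \<comment> \<open>Off the edges of \<open>G\<close> there is no edge of \<open>G'\<close> by
      \<open>refl\<close>, so the nonnegative weight in \<open>G'\<close> is 0, like the induced
      one.\<close>
    ultimately show ?thesis
      using weight_induced[OF inj that, of G'] refl[OF that]
      by (cases "edge G x y") (auto simp: edge_def[of G'] order_le_less)
  qed
  have "deg (induced \<phi> G G') (\<phi> (node G i)) = deg G' (\<phi> (node G i))"
    unfolding deg_def nodes_induced im[symmetric] by (intro sum.cong) (auto simp: w)
  then show ?thesis
    by (simp add: trans_prob_def w \<psi>)
qed

text \<open>Makes edges visible to stochastic equivalence. A positive weight is a summand of the
  degree, whose terms are nonnegative, so the denominator is positive too.\<close>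

lemma edge_iff_trans_prob:
  fixes G :: "('i::finite, 'a) wgraph"
  assumes "is_graph G"
  shows "edge G (node G i) (node G j) \<longleftrightarrow> trans_prob G i j > 0"
proof -
  have "deg G (node G i) \<ge> weight G (node G i) (node G j)"
    unfolding deg_def using assms
    by (intro member_le_sum) (auto simp: is_graph_def nodes_def)
  then show ?thesis
    using is_graphD(3)[OF assms, of i j]
    by (auto simp: edge_def trans_prob_def zero_less_divide_iff)
qed

text \<open>Used twice: for \<open>\<phi>\<close> with \<open>\<psi>\<close>, and for their inverses
  with the two graphs exchanged.\<close>

lemma stoch_equiv_via_imp_embeds:
  fixes G :: "('i::finite, 'a) wgraph" and G' :: "('j::finite, 'b) wgraph"
  assumes G: "is_graph G" and G': "is_graph G'"
    and eq: "stoch_equiv_via \<psi> G G'"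
    and \<phi>: "bij_betw \<phi> (nodes G) (nodes G')"
    and \<psi>: "\<And>i. node G' (\<psi> i) = \<phi> (node G i)"
  shows "embeds \<phi> (normalization G) (normalization G')"
proof -
  have p: "trans_prob G i j = trans_prob G' (\<psi> i) (\<psi> j)" for i j
    using eq by (simp add: stoch_equiv_via_def)
  \<comment> \<open>One direction gives edge preservation, the other the reflection that identifies
    the induced subgraph with \<open>G'\<close>.\<close>
  have e: "edge G' (\<phi> x) (\<phi> y) \<longleftrightarrow> edge G x y" if "x \<in> nodes G" "y \<in> nodes G" for x y
    using that by (auto simp: nodes_def \<psi>[symmetric] edge_iff_trans_prob[OF G]
        edge_iff_trans_prob[OF G'] p)
  show ?thesis
    unfolding embeds_normalization_iff[OF G]
  proof (intro conjI allI)
    show "preserves_edges \<phi> G G'"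
      using e by (auto simp: preserves_edges_def edge_def)
    show "trans_prob G i j = trans_prob (induced \<phi> G G') i j" for i j
      using trans_prob_induced_bij[OF G' \<phi> _ \<psi>] e p by simp
  qed (use \<phi> in \<open>auto simp: bij_betw_def\<close>)
qed

lemma stoch_equiv_iff_embeds:
  fixes G :: "('i::finite, 'a) wgraph" and G' :: "('j::finite, 'b) wgraph"
  assumes G: "is_graph G" and G': "is_graph G'"
  shows "stoch_equiv G G' \<longleftrightarrow>
    (\<exists>\<phi>. bij_betw \<phi> (nodes G) (nodes G') \<and>
         embeds \<phi> (normalization G) (normalization G') \<and>
         embeds (inv_into (nodes G) \<phi>) (normalization G') (normalization G))"
    (is "_ \<longleftrightarrow> ?R")
proof -
  have n: "bij_betw (node G) UNIV (nodes G)" and n': "bij_betw (node G') UNIV (nodes G')"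
    using is_graphD(1)[OF G] is_graphD(1)[OF G'] by (auto simp: bij_betw_def nodes_def)
  show ?thesis
  proof
    assume "stoch_equiv G G'"
    then obtain \<psi> where eq: "stoch_equiv_via \<psi> G G'"
      by (auto simp: stoch_equiv_def)
    then have bij: "bij \<psi>"
      by (simp add: stoch_equiv_via_def)
    then have eq': "stoch_equiv_via (inv \<psi>) G' G"
      using eq by (simp add: stoch_equiv_via_def bij_imp_bij_inv surj_f_inv_f bij_is_surj)
    \<comment> \<open>The index bijection is transported to the nodes through the two
      enumerations.\<close>
    define \<phi> where "\<phi> = node G' \<circ> \<psi> \<circ> inv (node G)"
    have \<psi>: "node G' (\<psi> i) = \<phi> (node G i)" for i
      by (simp add: \<phi>_def is_graphD(1)[OF G])
    have \<phi>: "bij_betw \<phi> (nodes G) (nodes G')"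
      unfolding \<phi>_def by (meson bij bij_betw_inv_into bij_betw_trans n n')
    have \<psi>': "node G (inv \<psi> i) = inv_into (nodes G) \<phi> (node G' i)" for i
      using \<psi>[of "inv \<psi> i"] \<phi> bij
      by (simp add: surj_f_inv_f bij_is_surj bij_betw_def)
    show ?R
      using \<phi> stoch_equiv_via_imp_embeds[OF G G' eq \<phi> \<psi>]
        stoch_equiv_via_imp_embeds[OF G' G eq' bij_betw_inv_into[OF \<phi>] \<psi>'] by blast
  next
    assume ?R
    then obtain \<phi> where \<phi>: "bij_betw \<phi> (nodes G) (nodes G')"
      and e: "embeds \<phi> (normalization G) (normalization G')"
      and e': "embeds (inv_into (nodes G) \<phi>) (normalization G') (normalization G)"
      by blast
    define \<psi> where "\<psi> = inv (node G') \<circ> (\<phi> \<circ> node G)"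
    have bij: "bij \<psi>"
      unfolding \<psi>_def by (meson bij_betw_inv_into bij_betw_trans n n' \<phi>)
    have \<psi>: "node G' (\<psi> i) = \<phi> (node G i)" for i
      using bij_betwE[OF \<phi>] by (simp add: \<psi>_def nodes_def[of G'] f_inv_into_f)
    \<comment> \<open>Edge preservation of the inverse embedding says that \<open>\<phi>\<close>
      reflects edges, so the induced subgraph in \<open>e\<close> has the transition probabilities
      of \<open>G'\<close>.\<close>
    have "edge G x y" if "x \<in> nodes G" "y \<in> nodes G" "edge G' (\<phi> x) (\<phi> y)" for x y
      using e' that \<phi> unfolding embeds_normalization_iff[OF G'] preserves_edges_def
      by (metis bij_betw_inv_into_left)
    then have "trans_prob G i j = trans_prob G' (\<psi> i) (\<psi> j)" for i j
      using e trans_prob_induced_bij[OF G' \<phi> _ \<psi>]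
      by (simp add: embeds_normalization_iff[OF G])
    then show "stoch_equiv G G'"
      using bij by (auto simp: stoch_equiv_def stoch_equiv_via_def)
  qed
qed

theorem theorem4p8:
  shows "(\<forall>(G :: ('i::finite, 'a) wgraph) (G' :: ('j::finite, 'b) wgraph).
            is_graph G \<and> is_graph G' \<longrightarrow>
            (stoch_equiv G G' \<longleftrightarrow>
              (\<exists>\<phi>. bij_betw \<phi> (nodes G) (nodes G') \<and>
                   embeds \<phi> (normalization G) (normalization G') \<and>
                   embeds (inv_into (nodes G) \<phi>) (normalization G') (normalization G))))
       \<and> (\<forall>(G :: ('k::finite, 'c) wgraph). is_graph G \<and> gmeas G = Counting \<longrightarrow>
            (\<forall>\<alpha>. 0 < \<alpha> \<and> \<alpha> < 1 \<longrightarrow>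
              (compatible (fractional_graph \<alpha> G) G \<longleftrightarrow>
               embeds id (normalization G) (normalization (fractional_graph \<alpha> G))))
          \<and> (\<forall>(d :: ('c \<Rightarrow> 'c \<Rightarrow> real) \<Rightarrow> 'c \<Rightarrow> 'c \<Rightarrow> real) (h :: real \<Rightarrow> real \<Rightarrow> real) \<alpha>.
               Metric_space (nodes G) (d (weight G)) \<and>
               (\<forall>\<beta>>0. \<forall>t\<ge>0. h \<beta> t > 0) \<and> 0 < \<alpha> \<longrightarrow>
               (compatible (path_graph d h \<alpha> G) G \<longleftrightarrow>
                embeds id (normalization G) (normalization (path_graph d h \<alpha> G)))))"
  using stoch_equiv_iff_embeds embeds_id_normalization_iff_compatible by blast

end
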